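(* Let $n\ge 2$ and $k=\lfloor n/2\rfloor$. Let $C_k(q)$ be the entry with index $k$ of the sequence obtained by applying $\mathcal{L}^2$ to the sequence of Gaussian polynomials $\left(\genfrac{[}{]}{0pt}{}{n}{j}_q\right)_{j\ge0}$. Then $$\operatorname{mint} C_k(q)=-q^{n-2}.$$ Consequently, the sequence $\left(\genfrac{[}{]}{0pt}{}{n}{j}_q\right)_{j\ge0}$ is not $2$-fold $q$-log-concave.
   Context: With $[n]_q=1+q+\cdots+q^{n-1}$ and $[n]_q!=[1]_q[2]_q\cdots[n]_q$, the Gaussian polynomials are $\genfrac{[}{]}{0pt}{}{n}{j}_q=\frac{[n]_q!}{[j]_q!\,[n-j]_q!}$ for $0\le j\le n$, and entries of the sequence with index $j<0$ or $j>n$ are taken to be $0$. For a sequence $(f_j)_{j\ge 0}$ of polynomials in $\mathbb{R}[q]$, with $f_j=0$ for $j<0$, the operator $\mathcal{L}$ is defined by $\mathcal{L}(f_j)=(g_j)_{j\ge 0}$ with $g_j=f_j^2-f_{j-1}f_{j+1}$. $\mathcal{L}^i$ is its $i$-fold iterate. For a nonzero polynomial $f(q)$, $\operatorname{mint} f(q)$ denotes the nonzero term of least degree in $f(q)$ (including its coefficient). A polynomial in $\mathbb{R}[q]$ is $q$-nonnegative if all its coefficients are nonnegative. A sequence $(f_j)$ of polynomials is $i$-fold $q$-log-concave if $\mathcal{L}^i(f_j)$ is a sequence of $q$-nonnegative polynomials. *)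

theory Defs
  imports Complex_Main "HOL-Computational_Algebra.Polynomial"
begin

text \<open>Elements of \<open>\<real>[q]\<close> have type \<^typ>\<open>real poly\<close>, and \<open>q^i\<close> is \<open>monom 1 i\<close>.\<close>

definition q_nat :: "nat \<Rightarrow> real poly" where
  "q_nat n = (\<Sum>i<n. monom 1 i)"

definition q_fact :: "nat \<Rightarrow> real poly" where
  "q_fact n = (\<Prod>i=1..n. q_nat i)"

text \<open>The division is polynomial division. It is exact, see \<open>q_fact_mult_gauss\<close> below.\<close>

definition gauss :: "nat \<Rightarrow> nat \<Rightarrow> real poly" where
  "gauss n j = (if j \<le> n then q_fact n div (q_fact j * q_fact (n - j)) else 0)"

text \<open>A sequence with \<open>f_j = 0\<close> for \<open>j < 0\<close> is represented by its restriction to \<open>j \<ge> 0\<close>;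
  the convention for negative indices enters only through \<open>f_{-1} = 0\<close>.\<close>

definition L_op :: "(nat \<Rightarrow> real poly) \<Rightarrow> nat \<Rightarrow> real poly" where
  "L_op f j = (f j)\<^sup>2 - (if j = 0 then 0 else f (j - 1)) * f (j + 1)"

text \<open>On the zero polynomial, where the notion is not meaningful, \<open>mint\<close> takes the value \<open>0\<close>;
  it is nonzero on every nonzero polynomial.\<close>

definition mint :: "real poly \<Rightarrow> real poly" where
  "mint p = (let d = (LEAST i. coeff p i \<noteq> 0) in monom (coeff p d) d)"

definition q_nonneg :: "real poly \<Rightarrow> bool" where
  "q_nonneg p \<longleftrightarrow> (\<forall>i. coeff p i \<ge> 0)"

definition fold_q_log_concave :: "nat \<Rightarrow> (nat \<Rightarrow> real poly) \<Rightarrow> bool" where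
  "fold_q_log_concave i f \<longleftrightarrow> (\<forall>j. q_nonneg ((L_op ^^ i) f j))"

lemma q_nat_add: "q_nat (a + b) = q_nat a + monom 1 a * q_nat b"
  by (induction b) (simp_all add: q_nat_def mult_monom algebra_simps)

lemma q_fact_0: "q_fact 0 = 1"
  by (simp add: q_fact_def)

lemma q_fact_Suc: "q_fact (Suc n) = q_nat (Suc n) * q_fact n"
  by (simp add: q_fact_def mult.commute)

lemma q_fact_mult_dvd: "q_fact j * q_fact m dvd q_fact (j + m)"
proof (induction "j + m" arbitrary: j m)
  case 0
  then show ?case by (simp add: q_fact_0)
next
  case (Suc s)
  show ?case
  proof (cases "j = 0 \<or> m = 0")
    case True
    then show ?thesis by (auto simp: q_fact_0)
  next
    case False
    then obtain a b where ab: "j = Suc a" "m = Suc b"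
      by (meson not0_implies_Suc)
    have 1: "q_fact a * q_fact m dvd q_fact s"
      using Suc.hyps(1)[of a m] Suc.hyps(2) ab by simp
    have 2: "q_fact j * q_fact b dvd q_fact s"
      using Suc.hyps(1)[of j b] Suc.hyps(2) ab by simp
    have "q_nat j * (q_fact a * q_fact m) dvd q_nat j * q_fact s"
      using 1 by (rule mult_dvd_mono[OF dvd_refl])
    then have 3: "q_fact j * q_fact m dvd q_nat j * q_fact s"
      by (simp only: ab q_fact_Suc mult_ac)
    have "q_nat m * (q_fact j * q_fact b) dvd q_nat m * q_fact s"
      using 2 by (rule mult_dvd_mono[OF dvd_refl])
    then have 4: "q_fact j * q_fact m dvd q_nat m * q_fact s"
      by (simp only: ab q_fact_Suc mult_ac)
    have "q_fact j * q_fact m dvd q_nat j * q_fact s + monom 1 j * (q_nat m * q_fact s)"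
      using 3 dvd_mult[OF 4] by (rule dvd_add)
    also have "\<dots> = q_fact (j + m)"
      by (simp add: Suc.hyps(2)[symmetric] q_fact_Suc)
         (simp add: Suc.hyps(2) q_nat_add algebra_simps)
    finally show ?thesis .
  qed
qed

lemma q_fact_mult_gauss:
  "j \<le> n \<Longrightarrow> q_fact j * q_fact (n - j) * gauss n j = q_fact n"
  using q_fact_mult_dvd[of j "n - j"] by (simp add: gauss_def)

lemma mint_eq_0_iff: "mint p = 0 \<longleftrightarrow> p = 0"
proof
  assume a: "mint p = 0"
  show "p = 0"
  proof (rule ccontr)
    assume "p \<noteq> 0"
    then have "\<exists>i. coeff p i \<noteq> 0" by (metis leading_coeff_0_iff)
    then have "coeff p (LEAST i. coeff p i \<noteq> 0) \<noteq> 0" by (rule LeastI_ex)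
    with a show False by (simp add: mint_def Let_def)
  qed
qed (simp add: mint_def)

end

theory Submission
  imports Defs
begin

text \<open>With \<open>m = n - j\<close>, the ratios of consecutive Gaussian polynomials give
  \<open>[j+1] [m+1] \<L>(f)_j = f_j\<^sup>2 (q^m [j] + q^j [m] + q^(j+m))\<close> for \<open>f_j = gauss n j\<close>, and all of
  \<open>[j+1]\<close>, \<open>[m+1]\<close>, \<open>f_j\<close> have constant term \<open>1\<close>. So \<open>\<L>(f)_j\<close> is divisible by \<open>q^(min j m)\<close>, and
  its least term is exactly \<open>q^(min j m)\<close> when \<open>j \<noteq> m\<close>. In \<open>\<L>(f)_k\<^sup>2 - \<L>(f)_(k-1) \<L>(f)_(k+1)\<close> the
  square then has order at least \<open>2k > n - 2\<close>, while the product begins with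
  \<open>q^(k-1) q^(n-k-1) = q^(n-2)\<close>.\<close>

lemma poly_0_q_nat: "poly (q_nat n) 0 = (if n = 0 then 0 else 1)"
  by (induction n) (auto simp: q_nat_def poly_monom power_0_left)

lemma poly_0_q_fact: "poly (q_fact n) 0 = 1"
  by (induction n) (simp_all add: q_fact_0 q_fact_Suc poly_0_q_nat)

lemma q_fact_neq_0: "q_fact n \<noteq> 0"
  using poly_0_q_fact[of n] by auto

lemma poly_0_gauss: "j \<le> n \<Longrightarrow> poly (gauss n j) 0 = 1"
  using arg_cong[OF q_fact_mult_gauss, of j n "\<lambda>p. poly p 0"] by (simp add: poly_0_q_fact)

text \<open>For \<open>j < n\<close>, both sides become \<open>q_fact n\<close> after multiplication
  by the nonzero factor \<open>q_fact j * q_fact (n - Suc j)\<close>. For \<open>j = n\<close> both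
  sides vanish.\<close>

lemma q_nat_mult_gauss_Suc:
  assumes "j \<le> n"
  shows "q_nat (Suc j) * gauss n (Suc j) = q_nat (n - j) * gauss n j"
proof (cases "j = n")
  case True
  then show ?thesis by (simp add: gauss_def q_nat_def)
next
  case False
  with assms have m: "n - j = Suc (n - Suc j)" and le: "Suc j \<le> n" by auto
  let ?c = "q_fact j * q_fact (n - Suc j)"
  have "?c * (q_nat (Suc j) * gauss n (Suc j)) = q_fact n"
    using q_fact_mult_gauss[OF le] by (simp add: q_fact_Suc mult_ac)
  also have "\<dots> = ?c * (q_nat (n - j) * gauss n j)"
    using q_fact_mult_gauss[OF assms] by (simp add: m q_fact_Suc mult_ac)
  finally show ?thesis by (simp add: q_fact_neq_0)
qed

lemma q_nat_mult_L_op_gauss: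
  assumes "j \<le> n"
  defines "m \<equiv> n - j"
  shows "q_nat (Suc j) * q_nat (Suc m) * L_op (gauss n) j
    = (gauss n j)\<^sup>2 * (monom 1 m * q_nat j + monom 1 j * q_nat m + monom 1 (j + m))"
proof -
  have up: "q_nat (Suc j) * gauss n (Suc j) = q_nat m * gauss n j"
    using q_nat_mult_gauss_Suc[OF assms(1)] by (simp add: m_def)
  let ?l = "if j = 0 then 0 else gauss n (j - 1)"
  \<comment> \<open>At \<open>j = 0\<close> the convention that entries of negative index are 0
    agrees with \<open>q_nat 0 = 0\<close>.\<close>
  have down: "q_nat (Suc m) * ?l = q_nat j * gauss n j"
  proof (cases j)
    case 0
    then show ?thesis by (simp add: q_nat_def)
  next
    case (Suc i)
    with assms have "n - i = Suc m" by auto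
    with q_nat_mult_gauss_Suc[of i n] Suc assms(1) show ?thesis by simp
  qed
  have "q_nat (Suc j) * q_nat (Suc m) * L_op (gauss n) j
    = q_nat (Suc j) * q_nat (Suc m) * (gauss n j)\<^sup>2
      - (q_nat (Suc m) * ?l) * (q_nat (Suc j) * gauss n (Suc j))"
    by (simp add: L_op_def algebra_simps)
  also have "\<dots> = (gauss n j)\<^sup>2 * (q_nat (Suc j) * q_nat (Suc m) - q_nat j * q_nat m)"
    unfolding up down by (simp add: algebra_simps power2_eq_square)
  \<comment> \<open>Expand with \<open>[j+1] = [j] + q^j\<close> and
    \<open>[m+1] = [m] + q^m\<close>; the product \<open>[j] [m]\<close> cancels.\<close>
  also have "q_nat (Suc j) * q_nat (Suc m) - q_nat j * q_nat m
    = monom 1 m * q_nat j + monom 1 j * q_nat m + monom 1 (j + m)"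
    by (simp add: q_nat_def algebra_simps mult_monom)
  finally show ?thesis .
qed

text \<open>A factor with constant term 1 is coprime to \<open>q\<close>, so the whole power
  \<open>q^d\<close> must divide \<open>p\<close>. Cancelling it and evaluating at 0 compares the
  constant terms.\<close>

lemma monom_mult_cancel_unit:
  fixes a p r :: "real poly"
  assumes "a * p = monom 1 d * r" and "poly a 0 = 1"
  obtains s where "p = monom 1 d * s" and "poly s 0 = poly r 0"
proof -
  have "\<exists>s. p = monom 1 d * s"
  proof (cases "p = 0")
    case False
    from assms(2) have "a \<noteq> 0" and a: "order 0 a = 0" by (auto intro: order_0I)
    with False have "order 0 (a * p) = order 0 p" by (simp add: order_mult)
    moreover have "monom 1 d dvd a * p" using assms(1) by simp
    ultimately have "monom 1 d dvd p"
      using False \<open>a \<noteq> 0\<close> by (simp add: monom_1_dvd_iff)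
    then show ?thesis by (auto simp: dvd_def)
  qed (intro exI[of _ 0], simp)
  then obtain s where s: "p = monom 1 d * s" ..
  with assms(1) have "monom 1 d * (a * s) = monom 1 d * r" by (simp add: mult_ac)
  then have "a * s = r" by (simp add: monom_eq_0_iff)
  with assms(2) have "poly s 0 = poly r 0" by auto
  with s that show thesis by blast
qed

lemma L_op_gauss_eq_monom_mult:
  assumes "j \<le> n"
  obtains s where "L_op (gauss n) j = monom 1 (min j (n - j)) * s"
    and "j \<noteq> n - j \<Longrightarrow> poly s 0 = 1"
proof -
  define m d where "m = n - j" and "d = min j m"
  define r where "r = (gauss n j)\<^sup>2 * (monom 1 (m - d) * q_nat j + monom 1 (j - d) * q_nat m
    + monom 1 (j + m - d))"
  have split: "monom 1 m = monom 1 d * monom (1::real) (m - d)"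
    "monom 1 j = monom 1 d * monom (1::real) (j - d)"
    "monom 1 (j + m) = monom 1 d * monom (1::real) (j + m - d)"
    by (simp_all add: d_def mult_monom)
  have "q_nat (Suc j) * q_nat (Suc m) * L_op (gauss n) j = monom 1 d * r"
    unfolding q_nat_mult_L_op_gauss[OF assms, folded m_def] split r_def
    by (simp only: distrib_left mult_ac)
  moreover have "poly (q_nat (Suc j) * q_nat (Suc m)) 0 = 1"
    by (simp add: poly_0_q_nat)
  ultimately obtain s where s: "L_op (gauss n) j = monom 1 d * s" "poly s 0 = poly r 0"
    by (rule monom_mult_cancel_unit)
  \<comment> \<open>Exactly one summand of \<open>r\<close> survives at 0: the one with
    \<open>q_nat m\<close> if \<open>j < m\<close>, the one with \<open>q_nat j\<close> if
    \<open>m < j\<close>. For \<open>j = m > 0\<close> both would, giving 2.\<close>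
  have "poly r 0 = 1" if "j \<noteq> m"
    using that assms
    by (auto simp: r_def d_def min_def poly_0_gauss poly_0_q_nat poly_monom power_0_left)
  with s that show thesis by (simp add: d_def m_def)
qed

lemma mint_monom_mult:
  assumes "poly p 0 \<noteq> 0"
  shows "mint (monom 1 d * p) = monom (poly p 0) d"
proof -
  have "(LEAST i. coeff (monom 1 d * p) i \<noteq> 0) = d"
    using assms by (intro Least_equality)
      (auto simp: coeff_monom_mult poly_0_coeff_0 split: if_splits)
  then show ?thesis
    by (simp add: mint_def coeff_monom_mult poly_0_coeff_0)
qed

theorem proposition5p2:
  fixes n k :: nat and C :: "nat \<Rightarrow> real poly"
  assumes "n \<ge> 2"
    and "k = n div 2"
    and "C = (L_op ^^ 2) (gauss n)"
  shows "mint (C k) = - monom 1 (n - 2) \<and> \<not> fold_q_log_concave 2 (gauss n)"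
proof -
  let ?B = "L_op (gauss n)"
  have k: "0 < k" "k \<le> n - k" "k + 1 \<le> n" "n < 2 * k + 2"
    using assms(1,2) by auto
  \<comment> \<open>For even \<open>n\<close> the index \<open>k\<close> is central, so
    \<open>poly s 0\<close> is left open; divisibility by \<open>q^k\<close> suffices here.\<close>
  obtain s where s: "?B k = monom 1 k * s"
    using L_op_gauss_eq_monom_mult[of k n] k by (auto simp: min_absorb1)
  \<comment> \<open>Since \<open>2(k-1) < n < 2(k+1)\<close>, the neighbours of \<open>k\<close> lie
    on opposite sides of the centre, which fixes both minima and makes the constant terms of
    \<open>t\<close> and \<open>u\<close> equal to 1.\<close>
  have "min (k - 1) (n - (k - 1)) = k - 1" "k - 1 \<noteq> n - (k - 1)" "k - 1 \<le> n"
    using k by auto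
  then obtain t where t: "?B (k - 1) = monom 1 (k - 1) * t" "poly t 0 = 1"
    using L_op_gauss_eq_monom_mult[of "k - 1" n] by metis
  have "min (k + 1) (n - (k + 1)) = n - (k + 1)" "k + 1 \<noteq> n - (k + 1)"
    using k by auto
  then obtain u where u: "?B (k + 1) = monom 1 (n - (k + 1)) * u" "poly u 0 = 1"
    using L_op_gauss_eq_monom_mult[of "k + 1" n] k(3) by metis
  \<comment> \<open>\<open>w\<close> is the cofactor of \<open>q^(n-2)\<close> in
    \<open>C k\<close>. The exponent \<open>2k - (n-2)\<close> is positive, so the square vanishes
    at 0 and only \<open>- t * u\<close> contributes there.\<close>
  define w where "w = monom 1 (2 * k - (n - 2)) * s\<^sup>2 - t * u"
  have "k + k = (n - 2) + (2 * k - (n - 2))"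
    using k assms(1) by linarith
  then have sq: "monom 1 k * monom 1 k = monom 1 (n - 2) * monom (1::real) (2 * k - (n - 2))"
    by (simp only: mult_monom mult_1_left)
  have pr: "monom 1 (k - 1) * monom 1 (n - (k + 1)) = monom (1::real) (n - 2)"
    using k by (simp add: mult_monom)
  have "C k = (?B k)\<^sup>2 - ?B (k - 1) * ?B (k + 1)"
    using k(1) assms(3) by (simp add: numeral_2_eq_2 L_op_def[of ?B])
  also have "\<dots> = (monom 1 k * monom 1 k) * s\<^sup>2
    - (monom 1 (k - 1) * monom 1 (n - (k + 1))) * (t * u)"
    unfolding s t u by (simp only: power2_eq_square mult_ac)
  also have "\<dots> = monom 1 (n - 2) * w"
    unfolding sq pr w_def by (simp add: algebra_simps)
  finally have C: "C k = monom 1 (n - 2) * w" .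
  have w: "poly w 0 = -1"
    using t(2) u(2) k by (simp add: w_def poly_monom power_0_left)
  have "mint (C k) = - monom 1 (n - 2)"
    unfolding C using w by (simp add: mint_monom_mult minus_monom)
  moreover have "coeff (C k) (n - 2) = -1"
    unfolding C using w by (simp add: coeff_monom_mult poly_0_coeff_0)
  then have "\<not> q_nonneg (C k)"
    unfolding q_nonneg_def by (metis neg_0_le_iff_le not_one_le_zero)
  then have "\<not> fold_q_log_concave 2 (gauss n)"
    unfolding fold_q_log_concave_def using assms(3) by blast
  ultimately show ?thesis ..
qed

end
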